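(* Let $G$ be a finite loopless graph without multiple edges, with at least one vertex. Then the two-variable interlace polynomial $q(G;x,y)$ is irreducible in $\mathbb{C}[x,y]$ if and only if $G$ is connected.
   Context: For a finite graph $G$ without multiple edges (loops allowed in general), the adjacency matrix $\mathcal{A}(G)=(a_{ij})$ over $\mathbb{F}_2$ is the symmetric matrix whose diagonal entry $a_{ii}$ is $1$ if and only if vertex $i$ is looped, and whose off-diagonal entry $a_{ij}$ is $1$ if and only if $i$ and $j$ are joined by an edge. For $S\subseteq V(G)$, $G[S]$ is the induced subgraph on $S$ (loops at vertices of $S$ are kept), and $r(G[S])$ and $n(G[S])=|S|-r(G[S])$ denote the rank and nullity over $\mathbb{F}_2$ of $\mathcal{A}(G[S])$ (both are $0$ for $S=\varnothing$). The two-variable interlace polynomial is $$q(G;x,y)=\sum_{S\subseteq V(G)}(x-1)^{r(G[S])}(y-1)^{n(G[S])}.$$ *)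

theory Defs
  imports
    "HOL-Library.Z2"
    "HOL-Computational_Algebra.Polynomial"
    "Jordan_Normal_Form.DL_Rank"
    "Graph_Theory.Graph_Theory"
begin

text \<open>
  An undirected graph is a symmetric digraph, as in the locale \<^locale>\<open>graph\<close>; a loop at \<open>v\<close> is an
  arc from \<open>v\<close> to \<open>v\<close>. Matrices are indexed by natural numbers, so the adjacency matrix is taken
  with respect to a list of the vertices.
\<close>

definition adjacency_matrix :: "('a, 'b) pre_digraph \<Rightarrow> 'a list \<Rightarrow> bit mat" where
  "adjacency_matrix G vs =
     mat (length vs) (length vs) (\<lambda>(i, j). if vs ! i \<rightarrow>\<^bsub>G\<^esub> vs ! j then 1 else 0)"

text \<open>
  Reordering the vertices permutes the rows and columns of the adjacency matrix simultaneously, so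
  the choice of the enumeration does not affect the rank.
\<close>

definition graph_rank :: "('a, 'b) pre_digraph \<Rightarrow> nat" where
  "graph_rank G =
     vec_space.rank (card (verts G))
       (adjacency_matrix G (SOME vs. distinct vs \<and> set vs = verts G))"

definition graph_nullity :: "('a, 'b) pre_digraph \<Rightarrow> nat" where
  "graph_nullity G = card (verts G) - graph_rank G"

text \<open>
  \<open>\<complex>[x,y]\<close> is represented as \<open>\<complex>[x][y]\<close>: the coefficients are polynomials in \<open>x\<close>.
\<close>

abbreviation poly_x :: "complex poly poly" where
  "poly_x \<equiv> [:[:0, 1:]:]"

abbreviation poly_y :: "complex poly poly" where
  "poly_y \<equiv> [:0, 1:]"

definition interlace_poly :: "('a, 'b) pre_digraph \<Rightarrow> complex poly poly" where
  "interlace_poly G =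
     (\<Sum>S\<in>Pow (verts G).
        (poly_x - 1) ^ graph_rank (G \<restriction> S) * (poly_y - 1) ^ graph_nullity (G \<restriction> S))"

end

theory Submission
  imports Defs
begin

text \<open>
  Write \<open>n(S)\<close> for the nullity of \<open>G[S]\<close> and \<open>N\<close> for the number of vertices. If \<open>G\<close> is disconnected, its
  vertex set splits into two nonempty parts without edges between them, the nullity is additive over
  the parts, and \<open>q\<close> is the product of the polynomials of the parts
  (\<open>corank_poly_disjoint_union\<close>). Neither factor is a unit, since
  \<open>q(0,0) = \<Sum>\<^sub>S (-1)\<^bsup>|S|\<^esup> = 0\<close> for every graph with a vertex.

  For the converse the decisive quantity is the derivative of \<open>q\<close> with respect to \<open>y\<close> at the origin, which
  equals \<open>\<beta>(G) = \<Sum>\<^sub>S (-1)\<^bsup>|S|+1\<^esup> n(S)\<close>; it plays the role that Crapo's beta invariant has for the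
  Tutte polynomial. Two facts are combined.

  First, if \<open>q = A B\<close> with nonunits \<open>A\<close> and \<open>B\<close>, then \<open>A(0,0) = B(0,0) = 0\<close>, so by the product rule
  \<open>\<beta>(G) = 0\<close>. Indeed, \<open>q(t,t) = \<Sum>\<^sub>S (t-1)\<^bsup>|S|\<^esup> = t\<^bsup>N\<^esup>\<close>, so \<open>A(t,t)\<close> is a constant times a
  power of \<open>t\<close>. On every line \<open>y = s x\<close> with \<open>s \<noteq> 0\<close> the restriction of \<open>q\<close> has the same degree \<open>N\<close>,
  because only \<open>S = V\<close> contributes in that degree. The degrees of \<open>A\<close> and \<open>B\<close> on the diagonal
  therefore already are their degrees on a generic line, and if \<open>A\<close> is constant on the diagonal it is
  constant (\<open>nonunit_factor_vanishes_at_origin\<close>).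

  Second, \<open>\<beta>(G) \<ge> 1\<close> when \<open>G\<close> is connected. For an edge \<open>a b\<close>, let \<open>G'\<close> be the pivot of \<open>G\<close> on that
  edge, with the vertex \<open>a\<close> removed. Pivoting matches the nullities of the subgraphs that contain \<open>a\<close>
  with those of the subgraphs of \<open>G'\<close>, with the same sign, which gives
  \<open>\<beta>(G) = \<beta>(G - a) + \<beta>(G')\<close> (\<open>corank_sum_pivot\<close>). Edgeless graphs have \<open>\<beta> \<in> {0, 1}\<close>, hence
  \<open>\<beta> \<ge> 0\<close> always, and \<open>\<beta>\<close> cannot decrease when a vertex is added that is adjacent to an old one. A
  connected graph is built up in this way from a single vertex, for which \<open>\<beta> = 1\<close>.
\<close>

section \<open>Kernels of principal submatrices and pivoting\<close>

definition dot :: "'a set \<Rightarrow> ('a \<Rightarrow> 'k::comm_ring_1) \<Rightarrow> ('a \<Rightarrow> 'k) \<Rightarrow> 'k" where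
  "dot S u x = (\<Sum>j\<in>S. u j * x j)"

lemma dot_insert: "finite S \<Longrightarrow> i \<notin> S \<Longrightarrow> dot (insert i S) u x = u i * x i + dot S u x"
  by (simp add: dot_def)

lemma dot_fun_upd: "i \<notin> S \<Longrightarrow> dot S u (x(i := t)) = dot S u x"
  unfolding dot_def by (intro sum.cong) auto

text \<open>
  The vectors in the kernel of \<open>A[S]\<close>, extended by zero outside \<open>S\<close>. Keeping all of them as functions
  on the same index type lets kernels for different \<open>S\<close> be compared directly. Over \<open>bit\<close> their number is a
  power of two, and its exponent is the nullity of \<open>A[S]\<close>.
\<close>
definition principal_kernel :: "('a \<Rightarrow> 'a \<Rightarrow> 'k::comm_ring_1) \<Rightarrow> 'a set \<Rightarrow> ('a \<Rightarrow> 'k) set" where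
  "principal_kernel A S = {x. (\<forall>i. i \<notin> S \<longrightarrow> x i = 0) \<and> (\<forall>i\<in>S. dot S (A i) x = 0)}"

text \<open>
  The pivot on the edge \<open>a b\<close>, as a matrix on the indices other than \<open>a\<close> (entries at \<open>a\<close> are
  meaningless). The last line is the Schur complement of the \<open>{a, b}\<close> block in characteristic two. The
  principal pivot transform exchanges the roles of \<open>a\<close> and \<open>b\<close>, and so the index \<open>b\<close> of the result
  carries the row of \<open>a\<close>.
\<close>
definition pivot :: "'a \<Rightarrow> 'a \<Rightarrow> ('a \<Rightarrow> 'a \<Rightarrow> 'k::comm_ring_1) \<Rightarrow> 'a \<Rightarrow> 'a \<Rightarrow> 'k" where
  "pivot a b A i j =
     (if i = b \<and> j = b then 0
      else if i = b then A a j
      else if j = b then A i a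
      else A i j + A i a * A b j + A i b * A a j)"

definition hollow_symmetric :: "('a \<Rightarrow> 'a \<Rightarrow> 'k::comm_ring_1) \<Rightarrow> bool" where
  "hollow_symmetric A \<longleftrightarrow> (\<forall>i j. A i j = A j i) \<and> (\<forall>i. A i i = 0)"

lemma hollow_symmetric_pivot:
  fixes A :: "'a \<Rightarrow> 'a \<Rightarrow> 'k::comm_ring_1"
  assumes two: "(2 :: 'k) = 0" and A: "hollow_symmetric A"
  shows "hollow_symmetric (pivot a b A)"
proof -
  have sym: "A i j = A j i" and alt: "A i i = 0" for i j using A by (auto simp: hollow_symmetric_def)
  show ?thesis
    using two sym alt by (auto simp: hollow_symmetric_def pivot_def mult.commute add.assoc add.commute)
qed

text \<open>
  All lemmas of this block compare, for one edge \<open>a b\<close>, kernels of \<open>A\<close> and of its pivot on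
  index sets that agree outside \<open>{a, b}\<close>. The coefficients enter only through \<open>2 = 0\<close>.
\<close>

context
  fixes A :: "'a \<Rightarrow> 'a \<Rightarrow> 'k::comm_ring_1" and a b :: 'a and R :: "'a set"
  assumes two: "(2 :: 'k) = 0" and A: "hollow_symmetric A"
    and ab: "A a b = 1" and fin: "finite R" and R: "a \<notin> R" "b \<notin> R"
begin

lemma add_self: "x + x = (0 :: 'k)" "x + (x + y) = y"
  using two by (simp_all add: mult_2[symmetric] add.assoc[symmetric])

lemma add_eq_0_iff_eq: "x + y = 0 \<longleftrightarrow> x = y" for x y :: 'k
  by (metis add_self)

lemma edge_entries: "a \<noteq> b" "b \<noteq> a" "A b a = 1" "A a a = 0" "A b b = 0"
  using ab A by (auto simp: hollow_symmetric_def)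

lemma dot_pivot:
  assumes "i \<in> R"
  shows "dot R (pivot a b A i) x = dot R (A i) x + A i a * dot R (A b) x + A i b * dot R (A a) x"
proof -
  have "dot R (pivot a b A i) x = (\<Sum>j\<in>R. A i j * x j + A i a * (A b j * x j) + A i b * (A a j * x j))"
    unfolding dot_def using assms R by (intro sum.cong refl) (auto simp: pivot_def algebra_simps)
  then show ?thesis by (simp add: dot_def sum.distrib sum_distrib_left)
qed

lemma dot_pivot_b: "dot R (pivot a b A b) x = dot R (A a) x"
  unfolding dot_def using R by (intro sum.cong) (auto simp: pivot_def)

lemma mem_principal_kernel_insert2:
  "x \<in> principal_kernel A (insert a (insert b R)) \<longleftrightarrow>
     (\<forall>i. i \<noteq> a \<and> i \<noteq> b \<and> i \<notin> R \<longrightarrow> x i = 0) \<and> x a = dot R (A b) x \<and> x b = dot R (A a) x \<and>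
     (\<forall>i\<in>R. dot R (A i) x = A i a * x a + A i b * x b)"
  unfolding principal_kernel_def using R fin edge_entries ab
  by (auto simp: dot_insert add_eq_0_iff_eq add.assoc[symmetric])

lemma mem_principal_kernel_pivot:
  "x \<in> principal_kernel (pivot a b A) R \<longleftrightarrow>
     (\<forall>i. i \<notin> R \<longrightarrow> x i = 0) \<and>
     (\<forall>i\<in>R. dot R (A i) x = A i a * dot R (A b) x + A i b * dot R (A a) x)"
  unfolding principal_kernel_def
  by (auto simp: dot_pivot add_eq_0_iff_eq add.assoc)

lemma mem_principal_kernel_insert:
  "x \<in> principal_kernel A (insert a R) \<longleftrightarrow>
     (\<forall>i. i \<noteq> a \<and> i \<notin> R \<longrightarrow> x i = 0) \<and> dot R (A a) x = 0 \<and>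
     (\<forall>i\<in>R. dot R (A i) x = A i a * x a)"
  unfolding principal_kernel_def using R fin edge_entries
  by (auto simp: dot_insert add_eq_0_iff_eq)

lemma mem_principal_kernel_pivot_insert:
  "x \<in> principal_kernel (pivot a b A) (insert b R) \<longleftrightarrow>
     (\<forall>i. i \<noteq> b \<and> i \<notin> R \<longrightarrow> x i = 0) \<and> dot R (A a) x = 0 \<and>
     (\<forall>i\<in>R. dot R (A i) x = A i a * (x b + dot R (A b) x))"
proof -
  have "pivot a b A b b = 0" by (simp add: pivot_def)
  moreover have "pivot a b A i b = A i a" if "i \<in> R" for i using R that by (auto simp: pivot_def)
  moreover have "u * v + (s + u * w + t * 0) = 0 \<longleftrightarrow> s = u * (v + w)"  for u v w s t :: 'k
    using add_eq_0_iff_eq[of s "u * (v + w)"] by (simp add: algebra_simps)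
  ultimately show ?thesis
    unfolding principal_kernel_def using R fin
    by (auto simp: dot_insert dot_pivot dot_pivot_b)
qed

text \<open>
  The equations in rows \<open>a\<close> and \<open>b\<close> determine \<open>x\<^sub>b\<close> and \<open>x\<^sub>a\<close> from the other coordinates; eliminating
  them leaves the system of the Schur complement.
\<close>
lemma card_principal_kernel_pivot_delete:
  "card (principal_kernel A (insert a (insert b R))) = card (principal_kernel (pivot a b A) R)"
proof (rule bij_betw_same_card)
  show "bij_betw (\<lambda>x. x(a := 0, b := 0)) (principal_kernel A (insert a (insert b R))) (principal_kernel (pivot a b A) R)"
    by (rule bij_betw_byWitness[where f' = "\<lambda>x. x(a := dot R (A b) x, b := dot R (A a) x)"])
      (use R edge_entries in \<open>auto simp: mem_principal_kernel_insert2 mem_principal_kernel_pivot dot_fun_upd fun_eq_iff\<close>)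
qed

text \<open>
  Both systems contain the equation of row \<open>a\<close>, which removes one of the two correction terms of the
  Schur complement; the other one is absorbed by the shift of the new coordinate \<open>x\<^sub>b\<close>.
\<close>
lemma card_principal_kernel_pivot_exchange:
  "card (principal_kernel A (insert a R)) = card (principal_kernel (pivot a b A) (insert b R))"
proof (rule bij_betw_same_card)
  show "bij_betw (\<lambda>x. x(a := 0, b := x a + dot R (A b) x))
     (principal_kernel A (insert a R)) (principal_kernel (pivot a b A) (insert b R))"
    by (rule bij_betw_byWitness[where f' = "\<lambda>x. x(b := 0, a := x b + dot R (A b) x)"])
      (use R edge_entries in \<open>auto simp: mem_principal_kernel_insert mem_principal_kernel_pivot_insert dot_fun_upd add_self add.assoc fun_eq_iff\<close>)
qed

end

section \<open>The alternating sum of coranks\<close>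

text \<open>
  The dimension of the kernel of \<open>A[S]\<close>. As a logarithm it is determined by the cardinality of the
  kernel alone, so that bijections of kernels suffice to compare coranks.
\<close>
definition corank :: "('a \<Rightarrow> 'a \<Rightarrow> bit) \<Rightarrow> 'a set \<Rightarrow> real" where
  "corank A S = log 2 (card (principal_kernel A S))"

definition corank_sum :: "('a \<Rightarrow> 'a \<Rightarrow> bit) \<Rightarrow> 'a set \<Rightarrow> real" where
  "corank_sum A V = (\<Sum>S\<in>Pow V. (-1) ^ (card S + 1) * corank A S)"

lemma sum_Pow_insert:
  assumes "finite V" "a \<notin> V"
  shows "(\<Sum>S\<in>Pow (insert a V). g S) = (\<Sum>S\<in>Pow V. g S + g (insert a S))"
proof -
  have "inj_on (insert a) (Pow V)" using assms by (auto simp: inj_on_def)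
  moreover have "Pow V \<inter> insert a ` Pow V = {}" using assms by auto
  ultimately show ?thesis
    using assms by (simp add: Pow_insert sum.union_disjoint sum.reindex sum.distrib)
qed

text \<open>
  The sets containing \<open>a\<close> are paired up as \<open>T \<union> {a}\<close> and \<open>T \<union> {a, b}\<close>, with \<open>a, b \<notin> T\<close>. Their coranks are
  the coranks of \<open>T \<union> {b}\<close> and \<open>T\<close> for the pivot, and the parities of the cardinalities agree.
\<close>
lemma corank_sum_pivot:
  assumes A: "hollow_symmetric A"
    and ab: "A a b = 1" and V: "finite V" "a \<notin> V" "b \<in> V"
  shows "corank_sum A (insert a V) = corank_sum A V + corank_sum (pivot a b A) V"
proof -
  let ?F = "\<lambda>A S. (-1) ^ (card S + 1) * corank A S"
  obtain R where R: "V = insert b R" "b \<notin> R" using V by (meson mk_disjoint_insert)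
  have "corank A (insert a T) = corank (pivot a b A) (insert b T)"
       "corank A (insert a (insert b T)) = corank (pivot a b A) T"
     if "T \<subseteq> R" for T
  proof -
    have "finite T" "a \<notin> T" "b \<notin> T" using V that R finite_subset[OF that] by auto
    from card_principal_kernel_pivot_delete[OF bit_2_eq_0 A ab this] card_principal_kernel_pivot_exchange[OF bit_2_eq_0 A ab this]
    show "corank A (insert a T) = corank (pivot a b A) (insert b T)"
       "corank A (insert a (insert b T)) = corank (pivot a b A) T" by (simp_all only: corank_def)
  qed
  moreover have "card (insert a (insert b T)) = card T + 2" "card (insert a T) = card T + 1" "card (insert b T) = card T + 1"
    if "T \<subseteq> R" for T
  proof -
    have "finite T" "a \<notin> insert b T" "b \<notin> T" using V that R finite_subset[OF that] by auto
    then show "card (insert a (insert b T)) = card T + 2" "card (insert a T) = card T + 1" "card (insert b T) = card T + 1"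
      by simp_all
  qed
  ultimately have eq: "?F A (insert a T) + ?F A (insert a (insert b T)) = ?F (pivot a b A) T + ?F (pivot a b A) (insert b T)"
    if "T \<subseteq> R" for T using that by simp
  have finR: "finite R" using V R by simp
  have "(\<Sum>T\<in>Pow V. ?F A (insert a T)) = (\<Sum>T\<in>Pow R. ?F A (insert a T) + ?F A (insert a (insert b T)))"
    unfolding R(1) by (rule sum_Pow_insert[OF finR R(2)])
  also have "\<dots> = (\<Sum>T\<in>Pow R. ?F (pivot a b A) T + ?F (pivot a b A) (insert b T))"
    by (intro sum.cong refl eq) simp
  also have "\<dots> = corank_sum (pivot a b A) V"
    unfolding corank_sum_def R(1) by (rule sum_Pow_insert[OF finR R(2), symmetric])
  finally show ?thesis unfolding corank_sum_def by (simp only: sum_Pow_insert[OF V(1,2)] sum.distrib)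
qed

lemma card_principal_kernel_zero:
  fixes A :: "'a \<Rightarrow> 'a \<Rightarrow> bit"
  assumes "finite S" "\<And>i j. i \<in> S \<Longrightarrow> j \<in> S \<Longrightarrow> A i j = 0"
  shows "card (principal_kernel A S) = 2 ^ card S"
proof -
  have "principal_kernel A S = {x. \<forall>i. i \<notin> S \<longrightarrow> x i = 0}"
    using assms(2) by (auto simp: principal_kernel_def dot_def)
  also have "card \<dots> = card (Pow S)"
  proof (rule bij_betw_same_card)
    show "bij_betw (\<lambda>x. {i. x i = 1}) {x :: 'a \<Rightarrow> bit. \<forall>i. i \<notin> S \<longrightarrow> x i = 0} (Pow S)"
    proof (rule bij_betw_byWitness[where f' = "\<lambda>T i. if i \<in> T then 1 else 0"])
      show "(\<lambda>x. {i. x i = 1}) ` {x :: 'a \<Rightarrow> bit. \<forall>i. i \<notin> S \<longrightarrow> x i = 0} \<subseteq> Pow S"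
        by (force simp del: bit_not_one_iff bit_not_zero_iff)
    qed (auto simp: fun_eq_iff)
  qed
  finally show ?thesis using assms by (simp add: card_Pow)
qed

text \<open>
  Here the corank is the cardinality, and with at least two vertices the sum is a second difference of
  a function that is linear in the cardinality.
\<close>
lemma corank_sum_edgeless:
  assumes "finite V" "\<And>i j. i \<in> V \<Longrightarrow> j \<in> V \<Longrightarrow> A i j = 0"
  shows "corank_sum A V = (if card V = 1 then 1 else 0)"
proof -
  let ?F = "\<lambda>S. (-1) ^ (card S + 1) * corank A S"
  have corank: "corank A S = card S" if "S \<subseteq> V" for S
  proof -
    have "card (principal_kernel A S) = 2 ^ card S" using that assms by (intro card_principal_kernel_zero) (auto intro: finite_subset)
    then show ?thesis by (simp add: corank_def log_pow_cancel)
  qed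
  consider "V = {}" | a where "V = {a}" | a b R where "V = insert a (insert b R)" "a \<noteq> b" "a \<notin> R" "b \<notin> R" "finite R"
  proof (cases "V = {}")
    case False
    then obtain a W where W: "V = insert a W" "a \<notin> W" by (meson ex_in_conv mk_disjoint_insert)
    show ?thesis
    proof (cases "W = {}")
      case False
      then obtain b R where "W = insert b R" "b \<notin> R" by (meson ex_in_conv mk_disjoint_insert)
      then show ?thesis using that(3)[of a b R] W assms(1) by auto
    qed (use that W in auto)
  qed (use that in auto)
  then show ?thesis
  proof cases
    case 3
    have "corank_sum A V = (\<Sum>T\<in>Pow R. ?F T + ?F (insert b T) + (?F (insert a T) + ?F (insert a (insert b T))))"
      unfolding corank_sum_def 3(1) using 3(2-) by (simp only: sum_Pow_insert finite_insert insert_iff simp_thms sum.distrib)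
    also have "\<dots> = 0"
    proof (rule sum.neutral, rule ballI)
      fix T assume "T \<in> Pow R"
      then have T: "finite T" "a \<notin> insert b T" "b \<notin> T"
         "T \<subseteq> V" "insert a T \<subseteq> V" "insert b T \<subseteq> V" "insert a (insert b T) \<subseteq> V"
        using 3 finite_subset[of T R] by auto
      \<comment> \<open>With \<open>m = |T|\<close>, the four terms are \<open>\<plusminus>(m - 2 (m + 1) + (m + 2))\<close>.\<close>
      have "corank A T = card T" "corank A (insert b T) = card T + 1" "corank A (insert a T) = card T + 1"
        "corank A (insert a (insert b T)) = card T + 2"
        "card (insert b T) = card T + 1" "card (insert a T) = card T + 1" "card (insert a (insert b T)) = card T + 2"
        using T(1-3) by (simp_all add: corank[OF T(4)] corank[OF T(5)] corank[OF T(6)] corank[OF T(7)])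
      then show "?F T + ?F (insert b T) + (?F (insert a T) + ?F (insert a (insert b T))) = 0"
        by (simp add: algebra_simps)
    qed
    finally have "corank_sum A V = 0" .
    moreover have "card V \<noteq> 1" using 3 by simp
    ultimately show ?thesis by simp
  next
    case (2 a)
    then have "corank A {a} = 1" using corank[of "{a}"] by simp
    moreover have "Pow {a} = {{}, {a}}" by auto
    ultimately show ?thesis using 2 corank[of "{}"] by (simp add: corank_sum_def)
  qed (auto simp: corank_sum_def corank)
qed

text \<open>
  Induction on the number of vertices: as long as there is an edge, the pivot recursion reduces to two
  matrices with one index less.
\<close>
lemma corank_sum_nonneg:
  assumes "finite V" and "hollow_symmetric A"
  shows "corank_sum A V \<ge> 0"
  using assms
proof (induction "card V" arbitrary: V A rule: less_induct)
  case less
  show ?case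
  proof (cases "\<exists>a\<in>V. \<exists>b\<in>V. A a b = 1")
    case True
    then obtain a b where ab: "a \<in> V" "b \<in> V" "A a b = 1" by blast
    define W where "W = V - {a}"
    have "a \<noteq> b" using ab less.prems by (auto simp: hollow_symmetric_def)
    then have W: "V = insert a W" "a \<notin> W" "b \<in> W" "finite W" using ab less.prems by (auto simp: W_def)
    note piv = hollow_symmetric_pivot[OF bit_2_eq_0 less.prems(2), of a b]
    have "corank_sum A W \<ge> 0" "corank_sum (pivot a b A) W \<ge> 0"
      using less.hyps[of W A] less.hyps[of W "pivot a b A"] less.prems piv W by auto
    then show ?thesis using corank_sum_pivot[OF less.prems(2) ab(3) W(4,2,3)] W(1) by simp
  next
    case False
    then have "A i j = 0" if "i \<in> V" "j \<in> V" for i j using that by (meson bit_not_one_iff)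
    then show ?thesis using corank_sum_edgeless[OF less.prems(1), of A] by simp
  qed
qed

text \<open>
  Since the second summand in the pivot recursion is nonnegative, the sum does not decrease when a
  vertex \<open>a\<close> with a neighbour in \<open>W\<close> is added to \<open>W\<close>. Hence a maximal set on which it is at least 1 has no
  outgoing edges, and connectedness, expressed through cuts, makes it everything.
\<close>
lemma corank_sum_pos:
  assumes "finite V" "V \<noteq> {}" and A: "hollow_symmetric A"
    and conn: "\<And>U. U \<subset> V \<Longrightarrow> U \<noteq> {} \<Longrightarrow> \<exists>i\<in>U. \<exists>j\<in>V - U. A i j = 1"
  shows "corank_sum A V \<ge> 1"
proof -
  define C where "C = {W. W \<subseteq> V \<and> W \<noteq> {} \<and> corank_sum A W \<ge> 1}"
  obtain v where v: "v \<in> V" using assms by blast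
  have "corank_sum A {v} = 1" using A by (subst corank_sum_edgeless) (auto simp: hollow_symmetric_def)
  then have "{v} \<in> C" using v by (auto simp: C_def)
  moreover have "finite C" using assms(1) by (auto simp: C_def)
  ultimately obtain W where W: "W \<in> C" and max: "\<And>X. X \<in> C \<Longrightarrow> W \<subseteq> X \<Longrightarrow> X = W"
    using finite_has_maximal[of C] by auto
  have "W = V"
  proof (rule ccontr)
    assume "W \<noteq> V"
    then obtain b a where ab: "b \<in> W" "a \<in> V - W" "A b a = 1" using conn[of W] W by (auto simp: C_def)
    have finW: "finite W" using W assms(1) by (auto simp: C_def intro: finite_subset)
    have ab1: "A a b = 1" using ab(3) A by (metis hollow_symmetric_def)
    note piv = hollow_symmetric_pivot[OF bit_2_eq_0 A, of a b]
    have "corank_sum A (insert a W) = corank_sum A W + corank_sum (pivot a b A) W"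
      using ab finW by (intro corank_sum_pivot[OF A ab1]) auto
    moreover have "corank_sum (pivot a b A) W \<ge> 0" using finW piv by (rule corank_sum_nonneg)
    ultimately have "insert a W \<in> C" using W ab by (auto simp: C_def)
    from max[OF this] show False using ab by auto
  qed
  then show ?thesis using W by (auto simp: C_def)
qed

section \<open>Bivariate polynomials on lines through the origin\<close>

text \<open>
  The polynomial \<open>poly p [:0, s:]\<close> is the restriction \<open>p(x, s x)\<close> of \<open>p\<close> to a line. Its degree is the
  total degree of \<open>p\<close> for all but finitely many \<open>s\<close>, so that total degrees of factors can be
  compared by choosing \<open>s\<close> generic.
\<close>

lemma poly_poly_at:
  fixes p :: "'k::field_char_0 poly poly"
  shows "poly (poly p z) x = poly (poly p [:poly z x:]) x"
  by (induction p) auto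

lemma coeff_on_line_polynomial:
  fixes p :: "'k::field_char_0 poly poly"
  shows "\<exists>c. \<forall>s. coeff (poly p [:0, s:]) k = poly c s"
proof (induction p arbitrary: k)
  case 0
  show ?case by (intro exI[of _ 0]) simp
next
  case (pCons a p)
  show ?case
  proof (cases k)
    case 0
    then show ?thesis by (intro exI[of _ "[:coeff a 0:]"]) (simp add: coeff_pCons)
  next
    case (Suc m)
    obtain c where "\<forall>s. coeff (poly p [:0, s:]) m = poly c s" using pCons.IH by blast
    then show ?thesis using Suc by (intro exI[of _ "pCons (coeff a k) c"]) simp
  qed
qed

lemma finite_degree_on_line_less:
  fixes p :: "'k::field_char_0 poly poly"
  shows "finite {s. degree (poly p [:0, s:]) < degree (poly p [:0, t:])}"
proof (cases "poly p [:0, t:] = 0")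
  case False
  define k where "k = degree (poly p [:0, t:])"
  obtain c where c: "\<And>s. coeff (poly p [:0, s:]) k = poly c s"
    using coeff_on_line_polynomial by blast
  have "poly c t \<noteq> 0" using False by (simp add: c[symmetric] k_def)
  then have "finite {s. poly c s = 0}" by (intro poly_roots_finite) auto
  moreover have "{s. degree (poly p [:0, s:]) < k} \<subseteq> {s. poly c s = 0}"
    by (auto simp: c[symmetric] coeff_eq_0)
  ultimately show ?thesis unfolding k_def by (rule rev_finite_subset)
qed simp

lemma constant_if_constant_on_lines:
  fixes p :: "'k::field_char_0 poly poly"
  assumes "\<And>s. degree (poly p [:0, s:]) = 0"
  shows "p = [:[:poly (poly p 0) 0:]:]"
proof -
  define r where "r = p - [:[:poly (poly p 0) 0:]:]"
  have "poly r [:0, s:] = 0" for s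
  proof -
    obtain c where c: "poly p [:0, s:] = [:c:]" using assms degree_eq_zeroE by blast
    then have "c = poly (poly p 0) 0" using poly_poly_at[of p "[:0, s:]" 0] by simp
    then show ?thesis using c by (simp add: r_def)
  qed
  then have "range (\<lambda>s. [:0, s:]) \<subseteq> {z. poly r z = 0}" by auto
  moreover have "infinite (range (\<lambda>s :: 'k. [:0, s:]))"
    using infinite_UNIV_char_0 by (auto dest!: finite_imageD simp: inj_on_def)
  ultimately have "r = 0" using poly_roots_finite infinite_super by blast
  then show ?thesis by (simp add: r_def)
qed

text \<open>
  If \<open>p(0,0) \<noteq> 0\<close>, then \<open>x\<close> does not divide \<open>p(x,x)\<close>, so all of \<open>x\<^sup>n\<close> goes into \<open>q(x,x)\<close>. This leaves
  degree zero for \<open>p\<close> on the diagonal and, by genericity, on every line.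
\<close>
lemma nonunit_factor_vanishes_at_origin:
  fixes p q :: "'k::field_char_0 poly poly"
  assumes deg: "\<And>s. s \<noteq> 0 \<Longrightarrow> degree (poly (p * q) [:0, s:]) = n"
    and diag: "poly (p * q) [:0, 1:] = monom 1 n"
    and "n > 0" and nonunit: "\<not> is_unit p"
  shows "poly (poly p 0) 0 = 0"
proof (rule ccontr)
  assume p0: "poly (poly p 0) 0 \<noteq> 0"
  have nz: "monom (1 :: 'k) n \<noteq> 0" by simp
  then have nz1: "poly p [:0, 1:] \<noteq> 0" "poly q [:0, 1:] \<noteq> 0" using diag by auto
  have "poly (poly p [:0, 1:]) 0 \<noteq> 0" using p0 poly_poly_at[of p "[:0, 1:]" 0] by simp
  then have "order 0 (poly p [:0, 1:]) = 0" by (simp add: order_0I)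
  moreover have "order 0 (poly p [:0, 1:] * poly q [:0, 1:]) = n"
    using diag by (simp add: order_0_monom)
  ultimately have "order 0 (poly q [:0, 1:]) = n" using nz1 by (simp add: order_mult)
  then have q1: "n \<le> degree (poly q [:0, 1:])" using order_degree[OF nz1(2), of 0] by simp
  \<comment> \<open>A positive degree of \<open>p\<close> on some line would persist on almost all lines. There \<open>q\<close> has degree at
    least \<open>n\<close>, its degree on the diagonal, so the degree of the product would exceed \<open>n\<close>.\<close>
  have "degree (poly p [:0, t:]) = 0" for t
  proof (rule ccontr)
    assume t: "degree (poly p [:0, t:]) \<noteq> 0"
    let ?F = "{s. degree (poly p [:0, s:]) < degree (poly p [:0, t:])} \<union>
              {s. degree (poly q [:0, s:]) < degree (poly q [:0, 1:])} \<union> {0}"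
    have "finite ?F" by (intro finite_UnI finite_degree_on_line_less) simp
    from ex_new_if_finite[OF infinite_UNIV_char_0 this] obtain s where s: "s \<notin> ?F" ..
    then have "degree (poly p [:0, s:]) > 0" "degree (poly q [:0, s:]) \<ge> n" using t q1 by auto
    moreover from this have "poly p [:0, s:] \<noteq> 0" by auto
    moreover have "degree (poly p [:0, s:] * poly q [:0, s:]) = n" using deg[of s] s by simp
    ultimately show False
      using \<open>n > 0\<close> by (cases "poly q [:0, s:] = 0") (auto simp: degree_mult_eq)
  qed
  from constant_if_constant_on_lines[OF this] p0 have "is_unit p"
    by (metis is_unit_const_poly_iff dvd_field_iff)
  then show False using nonunit by simp
qed

section \<open>The polynomial of a corank function\<close>

text \<open>
  The interlace polynomial in terms of the nullities only. The following lemmas hold for every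
  function \<open>\<nu>\<close> on the subsets of \<open>V\<close> that is bounded by the cardinality.
\<close>
definition corank_poly :: "('a set \<Rightarrow> nat) \<Rightarrow> 'a set \<Rightarrow> complex poly poly" where
  "corank_poly \<nu> V = (\<Sum>S\<in>Pow V. (poly_x - 1) ^ (card S - \<nu> S) * (poly_y - 1) ^ \<nu> S)"

lemma sum_Pow_power_card:
  fixes c :: "'c::comm_semiring_1"
  assumes "finite V"
  shows "(\<Sum>S\<in>Pow V. c ^ card S) = (c + 1) ^ card V"
  using prod_add[OF assms, of "\<lambda>_. c" "\<lambda>_. 1"] by simp

lemma corank_poly_line:
  "poly (corank_poly \<nu> V) [:0, s:] = (\<Sum>S\<in>Pow V. [:-1, 1:] ^ (card S - \<nu> S) * [:-1, s:] ^ \<nu> S)"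
  by (simp add: corank_poly_def poly_sum one_pCons)

context
  fixes \<nu> :: "'a set \<Rightarrow> nat" and V :: "'a set"
  assumes fin: "finite V" and le: "\<And>S. S \<subseteq> V \<Longrightarrow> \<nu> S \<le> card S"
begin

lemma corank_poly_diagonal: "poly (corank_poly \<nu> V) [:0, 1:] = monom 1 (card V)"
proof -
  have "poly (corank_poly \<nu> V) [:0, 1:] = (\<Sum>S\<in>Pow V. [:-1, 1:] ^ card S)"
    unfolding corank_poly_line by (intro sum.cong refl) (simp add: le power_add[symmetric])
  also have "\<dots> = [:0, 1:] ^ card V"
    using sum_Pow_power_card[OF fin, of "[:-1, 1 :: complex:]"] by (simp add: one_pCons)
  finally show ?thesis by (simp add: monom_altdef)
qed

text \<open>
  For \<open>s \<noteq> 0\<close> the summand of \<open>S\<close> has degree \<open>|S|\<close>, so the only summand of top degree is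
  that of \<open>V\<close> and nothing cancels.
\<close>
lemma degree_corank_poly_line:
  assumes s: "s \<noteq> 0"
  shows "degree (poly (corank_poly \<nu> V) [:0, s:]) = card V"
proof -
  let ?f = "\<lambda>S. [:-1, 1:] ^ (card S - \<nu> S) * [:-1, s:] ^ \<nu> S"
  have deg: "degree (?f S) = card S" if "S \<subseteq> V" for S
    using s le[OF that] by (simp add: degree_mult_eq degree_power_eq)
  have "degree (\<Sum>S\<in>Pow V - {V}. ?f S) < card V \<or> V = {}"
  proof (cases "V = {}")
    case False
    have "degree (?f S) < card V" if "S \<in> Pow V - {V}" for S
      using that deg[of S] fin by (auto intro: psubset_card_mono)
    then have "degree (\<Sum>S\<in>Pow V - {V}. ?f S) < card V"
      using False fin by (intro degree_sum_less) (auto simp: card_gt_0_iff)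
    then show ?thesis ..
  qed simp
  moreover have "poly (corank_poly \<nu> V) [:0, s:] = ?f V + (\<Sum>S\<in>Pow V - {V}. ?f S)"
    unfolding corank_poly_line using fin by (subst sum.remove[of _ V]) auto
  ultimately show ?thesis using deg[of V]
    by (auto simp: degree_add_eq_left)
qed

lemma corank_poly_derivative_at_origin:
  "poly (poly (pderiv (corank_poly \<nu> V)) 0) 0 = (\<Sum>S\<in>Pow V. (-1) ^ (card S + 1) * of_nat (\<nu> S))"
proof -
  have pd: "poly (poly (pderiv ((poly_x - 1) ^ k * (poly_y - 1) ^ m)) 0) 0 = (-1) ^ (k + m + 1) * of_nat m" for k m
  proof -
    have "pderiv ((poly_x - 1) ^ k) = 0"
      by (simp add: one_pCons poly_const_pow pderiv_pCons)
    moreover have "pderiv ((poly_y - 1) ^ Suc j) = Polynomial.smult (of_nat (Suc j)) ((poly_y - 1) ^ j)" for j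
      unfolding pderiv_power_Suc by (simp add: pderiv_diff pderiv_pCons)
    ultimately show ?thesis
      by (cases m) (simp_all only: pderiv_mult power_0 pderiv_1 poly_mult poly_add poly_smult poly_power poly_0 mult_zero_left,
         simp_all add: power_add)
  qed
  have "poly (poly (pderiv (corank_poly \<nu> V)) 0) 0 =
     (\<Sum>S\<in>Pow V. poly (poly (pderiv ((poly_x - 1) ^ (card S - \<nu> S) * (poly_y - 1) ^ \<nu> S)) 0) 0)"
    unfolding corank_poly_def higher_pderiv_sum[where n = "Suc 0", simplified] poly_sum ..
  also have "\<dots> = (\<Sum>S\<in>Pow V. (-1) ^ (card S + 1) * of_nat (\<nu> S))"
    unfolding pd by (intro sum.cong refl) (simp add: le)
  finally show ?thesis .
qed

lemma corank_poly_at_origin: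
  assumes "V \<noteq> {}"
  shows "poly (poly (corank_poly \<nu> V) 0) 0 = 0"
proof -
  have "poly (poly (corank_poly \<nu> V) 0) 0 = poly (poly (corank_poly \<nu> V) [:0, 1:]) 0"
    using poly_poly_at[of "corank_poly \<nu> V" "[:0, 1:]" 0] by simp
  moreover have "card V \<noteq> 0" using assms fin by simp
  ultimately show ?thesis by (simp add: corank_poly_diagonal poly_monom)
qed

text \<open>
  In a proper factorization both factors vanish at the origin, and then so does the derivative of the
  product, which is the sum in the hypothesis.
\<close>
lemma irreducible_corank_poly:
  assumes V: "V \<noteq> {}" and nz: "(\<Sum>S\<in>Pow V. (-1) ^ (card S + 1) * real (\<nu> S)) \<noteq> 0"
  shows "irreducible (corank_poly \<nu> V)"
proof (rule irreducibleI)
  show "corank_poly \<nu> V \<noteq> 0" using corank_poly_diagonal by auto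
  show "\<not> is_unit (corank_poly \<nu> V)"
  proof
    assume "is_unit (corank_poly \<nu> V)"
    then obtain u where "1 = corank_poly \<nu> V * u" by (rule dvdE)
    then have "poly (poly 1 0) 0 = poly (poly (corank_poly \<nu> V * u) 0) (0 :: complex)" by simp
    then show False using corank_poly_at_origin[OF V] by simp
  qed
  fix p q assume pq: "corank_poly \<nu> V = p * q"
  show "is_unit p \<or> is_unit q"
  proof (rule ccontr)
    assume "\<not> (is_unit p \<or> is_unit q)"
    then have "\<not> is_unit p" "\<not> is_unit q" by auto
    have "card V > 0" using V fin by (simp add: card_gt_0_iff)
    note factor = nonunit_factor_vanishes_at_origin[OF _ _ this]
    have "poly (poly p 0) 0 = 0"
      using factor[of p q] degree_corank_poly_line corank_poly_diagonal pq \<open>\<not> is_unit p\<close> by simp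
    moreover have "poly (poly q 0) 0 = 0"
      using factor[of q p] degree_corank_poly_line corank_poly_diagonal pq \<open>\<not> is_unit q\<close>
      by (simp add: mult.commute)
    ultimately have "poly (poly (pderiv (corank_poly \<nu> V)) 0) 0 = 0"
      by (simp add: pq pderiv_mult)
    then have "complex_of_real (\<Sum>S\<in>Pow V. (-1) ^ (card S + 1) * real (\<nu> S)) = 0"
      by (simp add: corank_poly_derivative_at_origin)
    then show False using nz by (simp only: of_real_eq_0_iff)
  qed
qed

end

lemma corank_poly_disjoint_union:
  assumes "finite V" "finite W" "V \<inter> W = {}"
    and add: "\<And>S T. S \<subseteq> V \<Longrightarrow> T \<subseteq> W \<Longrightarrow> \<nu> (S \<union> T) = \<nu> S + \<nu> T"
    and le: "\<And>S. S \<subseteq> V \<union> W \<Longrightarrow> \<nu> S \<le> card S"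
  shows "corank_poly \<nu> (V \<union> W) = corank_poly \<nu> V * corank_poly \<nu> W"
proof -
  let ?f = "\<lambda>S. (poly_x - 1) ^ (card S - \<nu> S) * (poly_y - 1) ^ \<nu> S"
  have mult: "?f S * ?f T = ?f (S \<union> T)" if "S \<subseteq> V" "T \<subseteq> W" for S T
  proof -
    have "card (S \<union> T) = card S + card T"
      using finite_subset[OF that(1) assms(1)] finite_subset[OF that(2) assms(2)] that assms(3)
      by (intro card_Un_disjoint) auto
    moreover have "\<nu> S \<le> card S" "\<nu> T \<le> card T" using that by (auto intro!: le)
    ultimately have "card (S \<union> T) - \<nu> (S \<union> T) = (card S - \<nu> S) + (card T - \<nu> T)"
      using add[OF that] by simp
    then show ?thesis by (simp only: add[OF that] power_add mult_ac)
  qed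
  have "corank_poly \<nu> V * corank_poly \<nu> W = (\<Sum>(S, T)\<in>Pow V \<times> Pow W. ?f S * ?f T)"
    unfolding corank_poly_def by (simp only: sum_product sum.cartesian_product)
  also have "\<dots> = (\<Sum>U\<in>Pow (V \<union> W). ?f U)"
  proof (rule sum.reindex_bij_witness[where i = "\<lambda>U. (U \<inter> V, U \<inter> W)" and j = "\<lambda>(S, T). S \<union> T"])
    fix ST assume "ST \<in> Pow V \<times> Pow W"
    then show "?f ((\<lambda>(S, T). S \<union> T) ST) = (\<lambda>(S, T). ?f S * ?f T) ST"
      using mult by (auto split: prod.splits)
  qed (use assms(3) in auto)
  finally show ?thesis unfolding corank_poly_def ..
qed

lemma not_irreducible_corank_poly:
  assumes "finite V" "finite W" "V \<inter> W = {}" "V \<noteq> {}" "W \<noteq> {}"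
    and add: "\<And>S T. S \<subseteq> V \<Longrightarrow> T \<subseteq> W \<Longrightarrow> \<nu> (S \<union> T) = \<nu> S + \<nu> T"
    and le: "\<And>S. S \<subseteq> V \<union> W \<Longrightarrow> \<nu> S \<le> card S"
  shows "\<not> irreducible (corank_poly \<nu> (V \<union> W))"
proof
  have nonunit: "\<not> is_unit (corank_poly \<nu> U)" if "finite U" "U \<noteq> {}" "U \<subseteq> V \<union> W" for U
  proof
    assume "is_unit (corank_poly \<nu> U)"
    then obtain u where "1 = corank_poly \<nu> U * u" by (rule dvdE)
    then have "poly (poly 1 0) 0 = poly (poly (corank_poly \<nu> U * u) 0) (0 :: complex)" by simp
    then show False using corank_poly_at_origin[OF that(1) le that(2)] that(3) by simp
  qed
  assume "irreducible (corank_poly \<nu> (V \<union> W))"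
  then have "is_unit (corank_poly \<nu> V) \<or> is_unit (corank_poly \<nu> W)"
    using corank_poly_disjoint_union[OF assms(1-3) add le] by (auto dest: irreducibleD)
  then show False using nonunit assms(1-5) by auto
qed

section \<open>Nullity and rank of induced subgraphs\<close>

lemma (in vectorspace) card_carrier_eq_card_field_power_dim:
  assumes fin: "finite (carrier V)"
  shows "card (carrier V) = card (carrier K) ^ dim"
proof -
  have fd: fin_dim
    unfolding fin_dim_def using fin in_own_span[of "carrier V"] span_is_subset2[of "carrier V"] by blast
  obtain B where B: "finite B" "B \<subseteq> carrier V" "basis B"
    using finite_basis_exists[OF fd] unfolding basis_def by blast
  have "bij_betw (\<lambda>c. lincomb c B) (B \<rightarrow>\<^sub>E carrier K) (carrier V)"
    unfolding bij_betw_def inj_on_def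
  proof (intro conjI ballI impI)
    fix c d assume cd: "c \<in> B \<rightarrow>\<^sub>E carrier K" "d \<in> B \<rightarrow>\<^sub>E carrier K" "lincomb c B = lincomb d B"
    then have "lincomb c B \<in> carrier V" using B by (auto intro!: lincomb_closed)
    then show "c = d" using basis_criterion[OF B(1,2)] B(3) cd by metis
  next
    show "(\<lambda>c. lincomb c B) ` (B \<rightarrow>\<^sub>E carrier K) = carrier V"
      using basis_criterion[OF B(1,2)] B by (fastforce intro!: lincomb_closed)
  qed
  from bij_betw_same_card[OF this] show ?thesis
    by (simp add: card_PiE B(1) dim_basis[OF B(1,3)])
qed

lemma finite_carrier_vec:
  assumes "finite (UNIV :: 'a set)"
  shows "finite (carrier_vec n :: 'a vec set)"
proof (rule finite_subset)
  show "carrier_vec n \<subseteq> vec n ` ({..<n} \<rightarrow>\<^sub>E (UNIV :: 'a set))"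
  proof
    fix v :: "'a vec" assume v: "v \<in> carrier_vec n"
    have "v = vec n (restrict (vec_index v) {..<n})" by (rule eq_vecI) (use v in auto)
    moreover have "restrict (vec_index v) {..<n} \<in> {..<n} \<rightarrow>\<^sub>E UNIV" by simp
    ultimately show "v \<in> vec n ` ({..<n} \<rightarrow>\<^sub>E UNIV)" by (rule image_eqI)
  qed
  show "finite (vec n ` ({..<n} \<rightarrow>\<^sub>E (UNIV :: 'a set)))"
    by (intro finite_imageI finite_PiE assms finite_lessThan)
qed

context vec_space
begin

text \<open>
  Over a finite field the rank of a matrix can be read off from the number of its kernel vectors, so
  that ranks can be compared by bijections between kernels.
\<close>
lemma card_kernel_eq_power_nullity:
  assumes fin: "finite (UNIV :: 'a set)" and M: "M \<in> carrier_mat n n"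
  shows "card {v \<in> carrier_vec n. M *\<^sub>v v = 0\<^sub>v n} = card (UNIV :: 'a set) ^ (n - rank M)" (is "card ?K = _")
    and "rank M \<le> n"
proof -
  interpret lm: linear_map class_ring V V "\<lambda>v. M *\<^sub>v v"
    using M by unfold_locales
      (simp add: LinearCombinations.module_hom_def mult_add_distrib_mat_vec[OF M] mult_mat_vec[OF M] class_ring_simps)
  have im: "lm.imT = col_space M"
    using col_space_eq[OF M] M unfolding lm.im_def by auto
  have ker: "lm.kerT = ?K"
    using M unfolding lm.ker_def by auto
  have sum: "rank M + vectorspace.dim class_ring (vs ?K) = n"
    using lm.rank_nullity[OF fin_dim] unfolding im ker rank_def dim_is_n
    by (simp add: col_space_def)
  interpret ker: vectorspace class_ring "vs ?K"
    using subspace_is_vs[OF lm.kerT_is_subspace] unfolding ker .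
  have "finite (carrier_vec n :: 'a vec set)" by (rule finite_carrier_vec[OF fin])
  then have "finite (carrier (vs ?K))" by simp
  note card = ker.card_carrier_eq_card_field_power_dim[OF this]
  have "n - rank M = ker.dim" using sum by simp
  show "card ?K = card (UNIV :: 'a set) ^ (n - rank M)"
    unfolding \<open>n - rank M = ker.dim\<close> using card by (simp only: carrier_vs_is_self module_vec_simps partial_object.simps)
  show "rank M \<le> n" using sum by linarith
qed

end

definition graph_adj :: "('a, 'b) pre_digraph \<Rightarrow> 'a \<Rightarrow> 'a \<Rightarrow> bit" where
  "graph_adj G i j = (if i \<rightarrow>\<^bsub>G\<^esub> j then 1 else 0)"

lemma hollow_symmetric_graph_adj:
  assumes "graph G"
  shows "hollow_symmetric (graph_adj G)"
proof -
  interpret graph G by fact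
  have "\<not> i \<rightarrow>\<^bsub>G\<^esub> i" for i
    using no_loops by (auto simp: arcs_ends_conv)
  then show ?thesis
    using graph_symmetric by (auto simp: hollow_symmetric_def graph_adj_def)
qed

lemma dominates_induce_subgraph_iff:
  "i \<in> S \<Longrightarrow> j \<in> S \<Longrightarrow> i \<rightarrow>\<^bsub>G \<restriction> S\<^esub> j \<longleftrightarrow> i \<rightarrow>\<^bsub>G\<^esub> j"
  by (auto simp: arcs_ends_conv)

text \<open>
  Enumerating \<open>S\<close> identifies the functions supported on \<open>S\<close> with vectors of dimension \<open>|S|\<close>.
  As \<open>vs\<close> is arbitrary, this covers the enumeration chosen by \<open>graph_rank\<close>.
\<close>
lemma card_principal_kernel_eq_card_mat_kernel:
  fixes A :: "'a \<Rightarrow> 'a \<Rightarrow> 'k::comm_ring_1"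
  assumes vs: "distinct vs" "set vs = S" and n: "n = length vs"
    and M: "M = mat n n (\<lambda>(k, l). A (vs ! k) (vs ! l))"
  shows "card {v \<in> carrier_vec n. M *\<^sub>v v = 0\<^sub>v n} = card (principal_kernel A S)"
proof -
  let ?vec = "\<lambda>x. vec n (\<lambda>k. x (vs ! k))"
  have bij: "bij_betw ((!) vs) {..<n} S"
    using bij_betw_nth[OF vs(1) refl vs(2)[symmetric]] n by simp
  have dot: "(M *\<^sub>v ?vec x) $ k = dot S (A (vs ! k)) x" if "k < n" for x k
  proof -
    have "(M *\<^sub>v ?vec x) $ k = (\<Sum>l\<in>{..<n}. A (vs ! k) (vs ! l) * x (vs ! l))"
      using that by (simp add: M scalar_prod_def lessThan_atLeast0)
    also have "\<dots> = dot S (A (vs ! k)) x"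
      unfolding dot_def by (rule sum.reindex_bij_betw[OF bij])
    finally show ?thesis .
  qed
  have S: "i \<in> S \<longleftrightarrow> (\<exists>k<n. i = vs ! k)" for i
    using vs(2) n by (auto simp: in_set_conv_nth)
  have zero: "M *\<^sub>v ?vec x = 0\<^sub>v n \<longleftrightarrow> (\<forall>i\<in>S. dot S (A i) x = 0)" for x
  proof -
    have "M *\<^sub>v ?vec x = 0\<^sub>v n \<longleftrightarrow> (\<forall>k<n. (M *\<^sub>v ?vec x) $ k = 0)"
      by (auto simp: vec_eq_iff M)
    then show ?thesis using dot S by auto
  qed
  have "bij_betw ?vec (principal_kernel A S) {v \<in> carrier_vec n. M *\<^sub>v v = 0\<^sub>v n}"
    unfolding bij_betw_def
  proof
    show "inj_on ?vec (principal_kernel A S)"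
    proof (rule inj_onI, rule ext)
      fix x y i assume xy: "x \<in> principal_kernel A S" "y \<in> principal_kernel A S" "?vec x = ?vec y"
      show "x i = y i"
      proof (cases "i \<in> S")
        case True
        then obtain k where "k < n" "i = vs ! k" using S by blast
        then show ?thesis using arg_cong[OF xy(3), of "\<lambda>v. v $ k"] by simp
      next
        case False
        then show ?thesis using xy(1,2) by (simp add: principal_kernel_def)
      qed
    qed
    show "?vec ` principal_kernel A S = {v \<in> carrier_vec n. M *\<^sub>v v = 0\<^sub>v n}"
    proof (intro equalityI subsetI)
      fix v assume "v \<in> ?vec ` principal_kernel A S"
      then obtain x where "v = ?vec x" "x \<in> principal_kernel A S" by (rule imageE)
      then show "v \<in> {v \<in> carrier_vec n. M *\<^sub>v v = 0\<^sub>v n}" using zero by (simp add: principal_kernel_def)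
    next
      fix v assume v: "v \<in> {v \<in> carrier_vec n. M *\<^sub>v v = 0\<^sub>v n}"
      define x where "x i = (if i \<in> S then v $ the_inv_into {..<n} ((!) vs) i else 0)" for i
      have "x (vs ! k) = v $ k" if "k < n" for k
        using that S by (auto simp: x_def the_inv_into_f_f[OF bij_betw_imp_inj_on[OF bij]])
      then have vx: "v = ?vec x" using v by (intro eq_vecI) auto
      have "\<forall>i\<in>S. dot S (A i) x = 0" using v unfolding zero[symmetric] vx[symmetric] by simp
      then have "x \<in> principal_kernel A S" by (simp add: principal_kernel_def x_def)
      with vx show "v \<in> ?vec ` principal_kernel A S" by (rule image_eqI)
    qed
  qed
  from bij_betw_same_card[OF this] show ?thesis ..
qed

lemma card_UNIV_bit: "card (UNIV :: bit set) = 2"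
proof -
  have "UNIV = {0, 1 :: bit}" using bit.exhaust by auto
  show ?thesis unfolding \<open>UNIV = {0, 1 :: bit}\<close> by simp
qed

lemma graph_rank_nullity:
  assumes "finite S"
  shows "graph_rank (G \<restriction> S) + graph_nullity (G \<restriction> S) = card S"
    and "card (principal_kernel (graph_adj G) S) = 2 ^ graph_nullity (G \<restriction> S)"
proof -
  define vs where "vs = (SOME vs. distinct vs \<and> set vs = S)"
  have "\<exists>vs. distinct vs \<and> set vs = S" using finite_distinct_list[OF assms] by blast
  then have vs: "distinct vs" "set vs = S" unfolding vs_def by (metis (mono_tags, lifting) someI_ex)+
  have len: "card S = length vs" using vs distinct_card by metis
  define M where "M = adjacency_matrix (G \<restriction> S) vs"
  have M: "M = mat (card S) (card S) (\<lambda>(k, l). graph_adj G (vs ! k) (vs ! l))"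
  proof (rule eq_matI)
    fix k l assume kl: "k < dim_row (mat (card S) (card S) (\<lambda>(k, l). graph_adj G (vs ! k) (vs ! l)))"
      "l < dim_col (mat (card S) (card S) (\<lambda>(k, l). graph_adj G (vs ! k) (vs ! l)))"
    then have "vs ! k \<in> S" "vs ! l \<in> S" using len vs(2) nth_mem by auto
    then show "M $$ (k, l) = mat (card S) (card S) (\<lambda>(k, l). graph_adj G (vs ! k) (vs ! l)) $$ (k, l)"
      using kl len by (simp add: M_def adjacency_matrix_def graph_adj_def dominates_induce_subgraph_iff del: induce_subgraph_ends)
  qed (simp_all add: M_def adjacency_matrix_def len)
  have carrier: "M \<in> carrier_mat (card S) (card S)" by (simp add: M)
  have rank: "graph_rank (G \<restriction> S) = vec_space.rank (card S) M"
    by (simp add: graph_rank_def M_def vs_def)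
  have fin: "finite (UNIV :: bit set)" by (rule card_ge_0_finite) (simp add: card_UNIV_bit)
  show sum: "graph_rank (G \<restriction> S) + graph_nullity (G \<restriction> S) = card S"
    using vec_space.card_kernel_eq_power_nullity(2)[OF fin carrier] by (simp add: graph_nullity_def rank)
  have "card (principal_kernel (graph_adj G) S) = card (UNIV :: bit set) ^ (card S - graph_rank (G \<restriction> S))"
    using vec_space.card_kernel_eq_power_nullity(1)[OF fin carrier]
      card_principal_kernel_eq_card_mat_kernel[OF vs len M] rank by simp
  then show "card (principal_kernel (graph_adj G) S) = 2 ^ graph_nullity (G \<restriction> S)"
    by (simp add: card_UNIV_bit graph_nullity_def)
qed

lemma interlace_poly_eq_corank_poly:
  assumes "finite (verts G)"
  shows "interlace_poly G = corank_poly (\<lambda>S. graph_nullity (G \<restriction> S)) (verts G)"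
  unfolding interlace_poly_def corank_poly_def
proof (intro sum.cong refl)
  fix S assume "S \<in> Pow (verts G)"
  then have "finite S" using assms finite_subset by auto
  from graph_rank_nullity(1)[OF this, of G]
  have "graph_rank (G \<restriction> S) = card S - graph_nullity (G \<restriction> S)" by simp
  then show "(poly_x - 1) ^ graph_rank (G \<restriction> S) * (poly_y - 1) ^ graph_nullity (G \<restriction> S) =
     (poly_x - 1) ^ (card S - graph_nullity (G \<restriction> S)) * (poly_y - 1) ^ graph_nullity (G \<restriction> S)" by simp
qed

text \<open>
  Without entries between \<open>S\<close> and \<open>T\<close> the linear system decouples, so a kernel vector is an
  arbitrary pair of kernel vectors for the two blocks.
\<close>
lemma card_principal_kernel_disjoint_union:
  fixes A :: "'a \<Rightarrow> 'a \<Rightarrow> 'k::comm_ring_1"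
  assumes fin: "finite S" "finite T" and disj: "S \<inter> T = {}"
    and no: "\<And>i j. i \<in> S \<Longrightarrow> j \<in> T \<Longrightarrow> A i j = 0 \<and> A j i = 0"
  shows "card (principal_kernel A (S \<union> T)) = card (principal_kernel A S) * card (principal_kernel A T)"
proof -
  let ?r = "\<lambda>U x i. if i \<in> U then x i else 0"
  have dotS: "dot (S \<union> T) (A i) x = dot S (A i) (?r S x)" if "i \<in> S" for i x
    using fin disj no that by (simp add: dot_def sum.union_disjoint)
  have dotT: "dot (S \<union> T) (A i) x = dot T (A i) (?r T x)" if "i \<in> T" for i x
    using fin disj no that by (simp add: dot_def sum.union_disjoint)
  have comb: "?r S (\<lambda>i. x i + y i) = x" "?r T (\<lambda>i. x i + y i) = y"
    if "x \<in> principal_kernel A S" "y \<in> principal_kernel A T" for x y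
    using that disj by (auto simp: principal_kernel_def fun_eq_iff)
  have "bij_betw (\<lambda>x. (?r S x, ?r T x)) (principal_kernel A (S \<union> T)) (principal_kernel A S \<times> principal_kernel A T)"
  proof (rule bij_betw_byWitness[where f' = "\<lambda>(x, y) i. x i + y i"])
    show "\<forall>x\<in>principal_kernel A (S \<union> T). (case (?r S x, ?r T x) of (x, y) \<Rightarrow> \<lambda>i. x i + y i) = x"
      using disj by (auto simp: principal_kernel_def fun_eq_iff)
    show "\<forall>z\<in>principal_kernel A S \<times> principal_kernel A T.
        (?r S (case z of (x, y) \<Rightarrow> \<lambda>i. x i + y i), ?r T (case z of (x, y) \<Rightarrow> \<lambda>i. x i + y i)) = z"
      using comb by auto
    show "(\<lambda>x. (?r S x, ?r T x)) ` principal_kernel A (S \<union> T) \<subseteq> principal_kernel A S \<times> principal_kernel A T"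
      by (auto simp: principal_kernel_def dotS[symmetric] dotT[symmetric])
    show "(\<lambda>(x, y) i. x i + y i) ` (principal_kernel A S \<times> principal_kernel A T) \<subseteq> principal_kernel A (S \<union> T)"
    proof clarify
      fix x y assume xy: "x \<in> principal_kernel A S" "y \<in> principal_kernel A T"
      have "dot (S \<union> T) (A i) (\<lambda>i. x i + y i) = 0" if "i \<in> S \<union> T" for i
      proof (cases "i \<in> S")
        case True
        then show ?thesis using xy(1) unfolding dotS[OF True] comb[OF xy] by (simp add: principal_kernel_def)
      next
        case False
        then have "i \<in> T" using that by simp
        then show ?thesis using xy(2) unfolding dotT[OF \<open>i \<in> T\<close>] comb[OF xy] by (simp add: principal_kernel_def)
      qed
      then show "(\<lambda>i. x i + y i) \<in> principal_kernel A (S \<union> T)"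
        using xy by (auto simp: principal_kernel_def)
    qed
  qed
  from bij_betw_same_card[OF this] show ?thesis by (simp add: card_cartesian_product)
qed

section \<open>Irreducibility and connectedness\<close>

lemma connected_iff_no_cut:
  assumes "graph G" and ne: "verts G \<noteq> {}"
  shows "connected G \<longleftrightarrow>
    (\<forall>U. U \<subset> verts G \<longrightarrow> U \<noteq> {} \<longrightarrow> (\<exists>i\<in>U. \<exists>j\<in>verts G - U. i \<rightarrow>\<^bsub>G\<^esub> j))"
proof -
  interpret graph G by fact
  have conn: "connected G \<longleftrightarrow> (\<forall>u\<in>verts G. \<forall>w\<in>verts G. u \<rightarrow>\<^sup>*\<^bsub>G\<^esub> w)"
    using ne by (simp add: connected_def strongly_connected_def reachable_mk_symmetric_eq[OF sym_arcs])
  show ?thesis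
  proof (intro iffI allI impI)
    fix U assume c: "connected G" and U: "U \<subset> verts G" "U \<noteq> {}"
    then obtain u w where uw: "u \<in> U" "w \<in> verts G" "w \<notin> U" by blast
    show "\<exists>i\<in>U. \<exists>j\<in>verts G - U. i \<rightarrow>\<^bsub>G\<^esub> j"
    proof (rule ccontr)
      assume no: "\<not> (\<exists>i\<in>U. \<exists>j\<in>verts G - U. i \<rightarrow>\<^bsub>G\<^esub> j)"
      have "u \<rightarrow>\<^sup>*\<^bsub>G\<^esub> w" using c conn uw U by blast
      then have "w \<in> U"
      proof (induction rule: reachable_induct)
        case (step v w)
        then have "w \<in> verts G" using adj_in_verts(2) by blast
        then show ?case using step no by blast
      qed (rule uw(1))
      then show False using uw by simp
    qed
  next
    assume cut: "\<forall>U. U \<subset> verts G \<longrightarrow> U \<noteq> {} \<longrightarrow> (\<exists>i\<in>U. \<exists>j\<in>verts G - U. i \<rightarrow>\<^bsub>G\<^esub> j)"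
    show "connected G"
      unfolding conn
    proof (intro ballI)
      fix u w assume uw: "u \<in> verts G" "w \<in> verts G"
      define U where "U = {v \<in> verts G. u \<rightarrow>\<^sup>*\<^bsub>G\<^esub> v}"
      have "u \<in> U" using uw by (simp add: U_def)
      moreover have "\<not> (\<exists>i\<in>U. \<exists>j\<in>verts G - U. i \<rightarrow>\<^bsub>G\<^esub> j)"
        unfolding U_def using reachable_adj_trans by blast
      ultimately have "\<not> U \<subset> verts G" using cut by blast
      then show "u \<rightarrow>\<^sup>*\<^bsub>G\<^esub> w" using uw by (auto simp: U_def)
    qed
  qed
qed

theorem theorem1p1:
  fixes G :: "('a, 'b) pre_digraph"
  assumes "graph G" and "verts G \<noteq> {}"
  shows "Factorial_Ring.irreducible (interlace_poly G) \<longleftrightarrow> Digraph_Component.connected G"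
proof -
  interpret graph G by fact
  let ?\<nu> = "\<lambda>S. graph_nullity (G \<restriction> S)"
  have fin: "finite S" if "S \<subseteq> verts G" for S
    using finite_subset[OF that] by simp
  have le: "?\<nu> S \<le> card S" if "S \<subseteq> verts G" for S
    using graph_rank_nullity(1)[OF fin[OF that], of G] by simp
  have eq: "interlace_poly G = corank_poly ?\<nu> (verts G)"
    by (rule interlace_poly_eq_corank_poly) simp
  show ?thesis
  proof
    assume conn: "connected G"
    have "corank_sum (graph_adj G) (verts G) \<ge> 1"
    proof (rule corank_sum_pos[OF finite_verts assms(2) hollow_symmetric_graph_adj[OF assms(1)]])
      fix U assume "U \<subset> verts G" "U \<noteq> {}"
      then obtain i j where "i \<in> U" "j \<in> verts G - U" "i \<rightarrow>\<^bsub>G\<^esub> j"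
        using conn connected_iff_no_cut[OF assms] by blast
      then show "\<exists>i\<in>U. \<exists>j\<in>verts G - U. graph_adj G i j = 1"
        by (intro bexI[of _ i] bexI[of _ j]) (auto simp: graph_adj_def)
    qed
    moreover have "corank_sum (graph_adj G) (verts G) = (\<Sum>S\<in>Pow (verts G). (-1) ^ (card S + 1) * real (?\<nu> S))"
      unfolding corank_sum_def
    proof (intro sum.cong refl)
      fix S assume "S \<in> Pow (verts G)"
      then have "corank (graph_adj G) S = real (?\<nu> S)"
        using graph_rank_nullity(2)[OF fin, of S G] by (simp add: corank_def log_pow_cancel)
      then show "(-1) ^ (card S + 1) * corank (graph_adj G) S = (-1) ^ (card S + 1) * real (?\<nu> S)" by simp
    qed
    ultimately show "irreducible (interlace_poly G)"
      unfolding eq using assms(2) by (intro irreducible_corank_poly) (auto simp: le)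
  next
    assume irr: "irreducible (interlace_poly G)"
    show "connected G"
    proof (rule ccontr)
      assume "\<not> connected G"
      then obtain U where U: "U \<subset> verts G" "U \<noteq> {}" and no: "\<And>i j. i \<in> U \<Longrightarrow> j \<in> verts G - U \<Longrightarrow> \<not> i \<rightarrow>\<^bsub>G\<^esub> j"
        using connected_iff_no_cut[OF assms] by blast
      have add: "?\<nu> (S \<union> T) = ?\<nu> S + ?\<nu> T" if "S \<subseteq> U" "T \<subseteq> verts G - U" for S T
      proof -
        have ST: "S \<subseteq> verts G" "T \<subseteq> verts G" "S \<inter> T = {}" using that U by auto
        have "card (principal_kernel (graph_adj G) (S \<union> T)) = card (principal_kernel (graph_adj G) S) * card (principal_kernel (graph_adj G) T)"
        proof (rule card_principal_kernel_disjoint_union[OF fin[OF ST(1)] fin[OF ST(2)] ST(3)])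
          fix i j assume "i \<in> S" "j \<in> T"
          then have "\<not> i \<rightarrow>\<^bsub>G\<^esub> j" "\<not> j \<rightarrow>\<^bsub>G\<^esub> i" using no that graph_symmetric by blast+
          then show "graph_adj G i j = 0 \<and> graph_adj G j i = 0" by (simp add: graph_adj_def)
        qed
        then have "(2 :: nat) ^ ?\<nu> (S \<union> T) = 2 ^ (?\<nu> S + ?\<nu> T)"
          using fin ST by (simp add: graph_rank_nullity(2) power_add)
        then show ?thesis by simp
      qed
      have V: "verts G = U \<union> (verts G - U)" using U by auto
      have "\<not> irreducible (corank_poly ?\<nu> (U \<union> (verts G - U)))"
        proof (rule not_irreducible_corank_poly)
        show "?\<nu> S \<le> card S" if "S \<subseteq> U \<union> (verts G - U)" for S
          using le[of S] that unfolding V[symmetric] .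
      qed (use U add fin in auto)
      then show False using irr eq V by simp
    qed
  qed
qed

end
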